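(* Let $k \ge 3$ and let $p_1, r, d$ be positive integers. (i) Suppose that $p_1 r^j + j d$ is prime for every $j = 0, 1, \dots, k-1$. Then $d$ is even, $p_1$ is an odd prime with $\gcd(p_1, d) = 1$, and $r$ is odd with $\gcd(r, d) = 1$. Moreover, if $r \ne 1$ then $k \le \min(p_1, r_1)$, where $r_1$ denotes the smallest prime factor of $r$; and if $r = 1$ then $k \le p_1$. (ii) Suppose $p_1 = 1$, $r \ne 1$, and $r^j + j d$ is prime for every $j = 1, 2, \dots, k$ (the term for $j=0$, which equals $1$, is excluded). Then $k \le r_1 - 1$, where $r_1$ is the smallest prime factor of $r$.
   Context: A geometric-arithmetic progression of primes of order $k$ (GAP-$k$) with start $p_1$, ratio $r$ and difference $d$ is a set of $k$ primes of the form $p_1 r^j + j d$ for consecutive $j$ (normally $j=0,\dots,k-1$, giving $p_1, p_1 r + d, p_1 r^2 + 2d, \dots$). When $p_1 = 1$ the initial term $1$ is not counted, since $1$ is not prime. *)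

theory Defs
  imports "HOL-Computational_Algebra.Primes"
begin

end

theory Submission
  imports Defs
begin

text \<open>A common divisor \<open>q\<close> of both summands divides the prime
  \<open>a + b\<close>, so \<open>q \<noteq> 1\<close> forces \<open>q = a + b\<close>, while
  \<open>q dvd a\<close> keeps \<open>q\<close> at most \<open>a\<close>. Primality of
  \<open>q\<close> is not assumed, so that \<open>q\<close> can be a gcd.\<close>

lemma prime_add_not_dvd:
  fixes q a b :: nat
  assumes "prime (a + b)" "a > 0" "b > 0" "q \<noteq> 1" "q dvd a"
  shows "\<not> q dvd b"
proof
  assume "q dvd b"
  with assms have "q dvd a + b" by simp
  with assms(1,4) have "q = a + b" using prime_nat_iff by blast
  moreover have "q \<le> a" using assms by (simp add: dvd_imp_le)
  ultimately show False using assms(3) by simp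
qed

lemma Min_prime_factors:
  fixes r :: nat
  assumes "r > 0" "r \<noteq> 1"
  shows "prime (Min (prime_factors r))" "Min (prime_factors r) dvd r"
proof -
  have "prime_factors r \<noteq> {}"
    using assms by (simp add: prime_factorization_empty_iff)
  then have "Min (prime_factors r) \<in> prime_factors r" by (intro Min_in) auto
  then show "prime (Min (prime_factors r))" "Min (prime_factors r) dvd r" by auto
qed

text \<open>If a prime \<open>q\<close> divides \<open>p r\<close>, then it divides the \<open>q\<close>-th term \<open>p r\<^sup>q + q d\<close> properly, so a
  progression of primes must stop before \<open>j = q\<close>. Applied to \<open>q = p\<close> and to prime factors \<open>q\<close>
  of \<open>r\<close>, this yields all the bounds on the length.\<close>

lemma geom_arith_term_not_prime:
  fixes p q r d :: nat
  assumes "p > 0" "r > 0" "d > 0" "prime q" "q dvd p * r"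
  shows "\<not> prime (p * r ^ q + q * d)"
proof
  assume pr: "prime (p * r ^ q + q * d)"
  have "q > 0" using \<open>prime q\<close> by (rule prime_gt_0_nat)
  then have "p * r dvd p * r ^ q" by (simp add: dvd_power)
  then have "q dvd p * r ^ q" using assms(5) dvd_trans by blast
  with pr have "\<not> q dvd q * d"
    using assms \<open>q > 0\<close> by (intro prime_add_not_dvd) auto
  then show False by simp
qed

theorem theorem1:
  fixes k p\<^sub>1 r d :: nat
  assumes "k \<ge> 3" and "p\<^sub>1 > 0" and "r > 0" and "d > 0"
  shows
    "((\<forall>j\<in>{0..k - 1}. prime (p\<^sub>1 * r ^ j + j * d)) \<longrightarrow>
        even d \<and>
        odd p\<^sub>1 \<and> prime p\<^sub>1 \<and> gcd p\<^sub>1 d = 1 \<and>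
        odd r \<and> gcd r d = 1 \<and>
        (r \<noteq> 1 \<longrightarrow> k \<le> min p\<^sub>1 (Min (prime_factors r))) \<and>
        (r = 1 \<longrightarrow> k \<le> p\<^sub>1)) \<and>
     (p\<^sub>1 = 1 \<and> r \<noteq> 1 \<and> (\<forall>j\<in>{1..k}. prime (r ^ j + j * d)) \<longrightarrow>
        k \<le> Min (prime_factors r) - 1)"
proof (rule conjI; rule impI)
  assume "\<forall>j\<in>{0..k - 1}. prime (p\<^sub>1 * r ^ j + j * d)"
  then have term_prime: "prime (p\<^sub>1 * r ^ j + j * d)" if "j < k" for j
    using that by auto
  have p: "prime p\<^sub>1" using term_prime[of 0] assms by simp
  have term1: "prime (p\<^sub>1 * r + d)" using term_prime[of 1] assms by simp
  \<comment> \<open>Here \<open>k \<ge> 3\<close> enters: in the term for \<open>j = 2\<close> the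
    summand \<open>2 * d\<close> is even, so the other one must be odd, which settles both parities
    at once.\<close>
  have "prime (p\<^sub>1 * r ^ 2 + 2 * d)" using term_prime[of 2] assms by simp
  then have "\<not> 2 dvd p\<^sub>1 * r ^ 2"
    using prime_add_not_dvd[of "p\<^sub>1 * r ^ 2" "2 * d" 2] assms by auto
  then have odds: "odd p\<^sub>1" "odd r" by auto
  \<comment> \<open>Excludes the even prime 2, so the term for \<open>j = 1\<close> is odd; as
    \<open>p\<^sub>1 * r\<close> is odd too, \<open>d\<close> must be even.\<close>
  have "p\<^sub>1 * r + d > 2"
  proof -
    have "p\<^sub>1 \<ge> 2" using p by (rule prime_ge_2_nat)
    moreover have "p\<^sub>1 * 1 \<le> p\<^sub>1 * r" using assms by (intro mult_le_mono2) simp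
    ultimately show ?thesis using assms by linarith
  qed
  with term1 have "odd (p\<^sub>1 * r + d)" by (rule prime_odd_nat)
  with odds have "even d" by simp
  \<comment> \<open>Taking any divisor \<open>x\<close> of \<open>p\<^sub>1 * r\<close> covers
    \<open>x = p\<^sub>1\<close> and \<open>x = r\<close> together.\<close>
  have coprime: "gcd x d = 1" if "x dvd p\<^sub>1 * r" for x
  proof (rule ccontr)
    assume "gcd x d \<noteq> 1"
    moreover have "gcd x d dvd p\<^sub>1 * r" using that by (meson dvd_trans gcd_dvd1)
    ultimately have "\<not> gcd x d dvd d"
      using term1 assms by (intro prime_add_not_dvd[of "p\<^sub>1 * r"]) auto
    then show False by simp
  qed
  \<comment> \<open>If \<open>q < k\<close>, the term for \<open>j = q\<close> would be among those
    assumed prime.\<close>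
  have bound: "k \<le> q" if "prime q" "q dvd p\<^sub>1 * r" for q
    using geom_arith_term_not_prime[OF assms(2-4) that] term_prime[of q] by linarith
  have "k \<le> p\<^sub>1" using p by (rule bound) simp
  moreover have "k \<le> Min (prime_factors r)" if "r \<noteq> 1"
    using Min_prime_factors[OF assms(3) that] by (intro bound) auto
  ultimately show "even d \<and> odd p\<^sub>1 \<and> prime p\<^sub>1 \<and> gcd p\<^sub>1 d = 1 \<and> odd r \<and> gcd r d = 1 \<and>
        (r \<noteq> 1 \<longrightarrow> k \<le> min p\<^sub>1 (Min (prime_factors r))) \<and> (r = 1 \<longrightarrow> k \<le> p\<^sub>1)"
    using p odds \<open>even d\<close> coprime by simp
next
  assume h: "p\<^sub>1 = 1 \<and> r \<noteq> 1 \<and> (\<forall>j\<in>{1..k}. prime (r ^ j + j * d))"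
  define q where "q = Min (prime_factors r)"
  have q: "prime q" "q dvd r" using Min_prime_factors[OF assms(3)] h by (auto simp: q_def)
  have "\<not> prime (r ^ q + q * d)"
    using geom_arith_term_not_prime[of 1 r d q] q assms by simp
  \<comment> \<open>The indices now run up to \<open>k\<close> instead of \<open>k - 1\<close>;
    since \<open>q\<close> is positive, it must exceed \<open>k\<close>, hence the bound
    \<open>q - 1\<close>.\<close>
  then have "q \<notin> {1..k}" using h by blast
  with prime_gt_0_nat[OF q(1)] show "k \<le> Min (prime_factors r) - 1"
    by (auto simp flip: q_def)
qed

end
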